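(* Let $\mu,\nu\in\mathrm{M}_0(\mathbb{R})$, and consider the inequalities $$\mu(\mathbb{R}_{>0})\ge\nu(\mathbb{R}_{>0})\quad\text{and}\quad\mu(\mathbb{R}_{<0})\ge\nu(\mathbb{R}_{<0}).\qquad( * )$$ If $( * )$ holds and $\gamma$ is a zero-coupling between $\mu$ and $\nu$ with monotone support, then $\gamma$ is proper. Conversely, if at least one of $\mu$ or $\nu$ has infinite mass, then the existence of a proper zero-coupling between $\mu$ and $\nu$ with monotone support implies that both inequalities in $( * )$ are satisfied.
   Context: $\mathrm{M}_0(\mathbb{R}^k)$ denotes the set of nonnegative Borel measures $\mu$ on $\mathbb{R}^k\setminus\{0\}$ such that $\mu(B)<\infty$ for every Borel set $B\subset\mathbb{R}^k\setminus\{0\}$ with $0\notin \mathrm{cl}(B)$ (closure in $\mathbb{R}^k$). The support $\mathrm{spt}\,\mu$ is the set of $x\in\mathbb{R}^k$ such that $\mu(U\setminus\{0\})>0$ for every open $U\subset\mathbb{R}^k$ containing $x$ (so $0$ may belong to $\mathrm{spt}\,\mu$). For $\mu,\nu\in\mathrm{M}_0(\mathbb{R})$, a zero-coupling between $\mu$ and $\nu$ is a nonnegative Borel measure $\gamma$ on $\mathbb{R}^2\setminus\{(0,0)\}$ such that $\gamma(A\times\mathbb{R})=\mu(A)$ and $\gamma(\mathbb{R}\times A)=\nu(A)$ for all Borel $A\subset\mathbb{R}\setminus\{0\}$; any such $\gamma$ belongs to $\mathrm{M}_0(\mathbb{R}^2)$. Its support is monotone if $(x_1-x_2)(y_1-y_2)\ge0$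 for all $(x_1,y_1),(x_2,y_2)\in\mathrm{spt}\,\gamma$. A zero-coupling $\gamma$ is proper if $\gamma(\{0\}\times(\mathbb{R}\setminus\{0\}))=0$. *)

theory Defs
  imports "HOL-Analysis.Analysis"
begin

text \<open>
  The spaces \<open>\<real>\<^sup>k\<close> are rendered by types of class \<open>euclidean_space\<close>; the cases needed are
  \<open>real\<close> and \<open>real \<times> real\<close>, whose zero is \<open>(0, 0)\<close>. A Borel measure on the punctured space is a
  measure whose underlying space is \<open>- {0}\<close> and whose sigma-algebra is the trace of the Borel sets.
\<close>

definition punctured_borel :: "'a::euclidean_space measure" where
  "punctured_borel = restrict_space borel (- {0})"

lemma sets_punctured_borel_iff: "A \<in> sets punctured_borel \<longleftrightarrow> A \<in> sets borel \<and> 0 \<notin> A"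
  unfolding punctured_borel_def by (subst sets_restrict_space_iff) auto

lemma space_punctured_borel: "space punctured_borel = - {0}"
  unfolding punctured_borel_def by (simp add: space_restrict_space)

definition M0 :: "'a::euclidean_space measure set" where
  "M0 = {\<mu>. sets \<mu> = sets punctured_borel \<and>
             (\<forall>B \<in> sets punctured_borel. 0 \<notin> closure B \<longrightarrow> emeasure \<mu> B < \<infinity>)}"

text \<open>The support is taken in the whole space, so it may contain \<open>0\<close>.\<close>

definition spt :: "'a::euclidean_space measure \<Rightarrow> 'a set" where
  "spt \<mu> = {x. \<forall>U. open U \<and> x \<in> U \<longrightarrow> emeasure \<mu> (U - {0}) > 0}"

definition zero_coupling :: "real measure \<Rightarrow> real measure \<Rightarrow> (real \<times> real) measure \<Rightarrow> bool" where
  "zero_coupling \<mu> \<nu> \<gamma> \<longleftrightarrow>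
     sets \<gamma> = sets punctured_borel \<and>
     (\<forall>A \<in> sets punctured_borel.
        emeasure \<gamma> (A \<times> UNIV) = emeasure \<mu> A \<and> emeasure \<gamma> (UNIV \<times> A) = emeasure \<nu> A)"

definition monotone_set :: "(real \<times> real) set \<Rightarrow> bool" where
  "monotone_set S \<longleftrightarrow>
     (\<forall>(x1, y1) \<in> S. \<forall>(x2, y2) \<in> S. (x1 - x2) * (y1 - y2) \<ge> 0)"

definition proper :: "(real \<times> real) measure \<Rightarrow> bool" where
  "proper \<gamma> \<longleftrightarrow> emeasure \<gamma> ({0} \<times> (- {0})) = 0"

end

theory Submission
  imports Defs
begin

text \<open>
  A coupling \<open>\<gamma>\<close> is concentrated on its support
  (\<open>emeasure_eq_0_if_disjoint_spt\<close>), so monotonicity of the support controls how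
  \<open>\<gamma>\<close> can distribute its mass over the quadrants and the axes.

  For the first claim, suppose that \<open>\<gamma>\<close> charges the positive
  \<open>y\<close>-axis. Then some \<open>(0, y\<^sub>0)\<close> with \<open>y\<^sub>0 > 0\<close>
  lies in the support, and monotonicity forces all the mass over \<open>x > 0\<close> into the
  half-plane \<open>y \<ge> y\<^sub>0\<close>. Hence \<open>\<mu>\<close> has finite mass on the
  positive half-line (at most \<open>\<nu>\<close> of \<open>[y\<^sub>0, \<infinity>)\<close>),
  and \<open>\<nu>\<close> has to accommodate this finite mass and in addition the mass of the
  axis. So \<open>\<nu>\<close> would have strictly more mass on the positive half-line than
  \<open>\<mu>\<close> (\<open>axis_half_line_null\<close>).

  For the second claim, outside every neighbourhood of the origin \<open>\<gamma>\<close> has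
  finite mass (\<open>zero_coupling_in_M0\<close>), so a marginal of infinite mass makes the
  origin a point of the support (\<open>zero_in_spt_if_infinite_mass\<close>). By monotonicity the
  support then avoids the open second and fourth quadrants. For a proper \<open>\<gamma>\<close>,
  all the mass over \<open>y > 0\<close> must therefore come from \<open>x > 0\<close>
  (\<open>half_line_mass_le\<close>).

  Both half-lines are treated at once by writing them as \<open>{t. s * t > 0}\<close> with
  \<open>s = 1\<close> or \<open>s = -1\<close>.
\<close>

section \<open>Supports on the punctured space\<close>

text \<open>
  Points outside the support have null neighbourhoods, and countably many of these suffice to
  cover a set that misses the support, since the space is second countable.
\<close>

lemma emeasure_eq_0_if_disjoint_spt:
  fixes \<gamma> :: "'a::euclidean_space measure"
  assumes sets: "sets \<gamma> = sets punctured_borel"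
    and zero: "0 \<notin> B" and disj: "B \<inter> spt \<gamma> = {}"
  shows "emeasure \<gamma> B = 0"
proof -
  define \<F> where "\<F> = {U. open U \<and> emeasure \<gamma> (U - {0}) = 0}"
  obtain \<F>' where \<F>': "\<F>' \<subseteq> \<F>" "countable \<F>'" "\<Union>\<F>' = \<Union>\<F>"
    using Lindelof[of \<F>] unfolding \<F>_def by auto
  have meas: "U - {0} \<in> sets \<gamma>" if "open U" for U
    using that unfolding sets sets_punctured_borel_iff by auto
  have "B \<subseteq> (\<Union>U\<in>\<F>'. U - {0})"
  proof
    fix x assume x: "x \<in> B"
    then have "x \<notin> spt \<gamma>" using disj by auto
    then obtain U where "open U" "x \<in> U" "emeasure \<gamma> (U - {0}) = 0"
      unfolding spt_def by (auto simp: not_gr_zero)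
    then have "x \<in> \<Union>\<F>" unfolding \<F>_def by auto
    then show "x \<in> (\<Union>U\<in>\<F>'. U - {0})" using \<F>'(3) x zero by auto
  qed
  moreover have "(\<Union>U\<in>\<F>'. U - {0}) \<in> null_sets \<gamma>"
    using \<F>' meas by (intro null_sets_UN') (auto simp: \<F>_def null_sets_def)
  ultimately show ?thesis
    by (auto intro: emeasure_eq_0)
qed

text \<open>
  The mass outside any neighbourhood of the origin is finite, so all the excess is inside it.
\<close>

lemma zero_in_spt_if_infinite_mass:
  fixes \<gamma> :: "'a::euclidean_space measure"
  assumes \<gamma>: "\<gamma> \<in> M0" and inf: "emeasure \<gamma> (space \<gamma>) = \<infinity>"
  shows "0 \<in> spt \<gamma>"
  unfolding spt_def
proof (intro CollectI allI impI, elim conjE)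
  fix U :: "'a set" assume U: "open U" "0 \<in> U"
  have sets: "sets \<gamma> = sets punctured_borel" using \<gamma> unfolding M0_def by auto
  then have space: "space \<gamma> = - {0}"
    using sets_eq_imp_space_eq[OF sets] by (simp add: space_punctured_borel)
  have meas: "U - {0} \<in> sets \<gamma>" "- U \<in> sets \<gamma>"
    using U unfolding sets sets_punctured_borel_iff by auto
  have "closure (- U) = - U" using U by (intro closure_closed) auto
  then have fin: "emeasure \<gamma> (- U) < \<infinity>"
    using \<gamma> U meas sets unfolding M0_def by auto
  have "- {0} = (U - {0}) \<union> - U" using U by auto
  then have "\<infinity> \<le> emeasure \<gamma> (U - {0}) + emeasure \<gamma> (- U)"
    using emeasure_subadditive[OF meas] inf space by simp
  then show "emeasure \<gamma> (U - {0}) > 0"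
    using fin by (cases "emeasure \<gamma> (U - {0}) = 0") (auto simp: top_unique zero_less_iff_neq_zero)
qed

section \<open>Zero-couplings\<close>

lemma sets_zero_coupling:
  assumes "zero_coupling \<mu> \<nu> \<gamma>" "A \<in> sets borel" "B \<in> sets borel" "0 \<notin> A \<or> 0 \<notin> B"
  shows "A \<times> B \<in> sets \<gamma>"
  using assms unfolding zero_coupling_def
  by (auto simp: sets_punctured_borel_iff zero_prod_def intro: borel_Times)

lemma zero_coupling_marginals:
  assumes "zero_coupling \<mu> \<nu> \<gamma>" "A \<in> sets borel" "0 \<notin> A"
  shows "emeasure \<gamma> (A \<times> UNIV) = emeasure \<mu> A" "emeasure \<gamma> (UNIV \<times> A) = emeasure \<nu> A"
  using assms unfolding zero_coupling_def by (auto simp: sets_punctured_borel_iff)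

text \<open>
  A set bounded away from the origin need not have projections bounded away from \<open>0\<close>, but it is
  covered by two cylinders over complements of neighbourhoods of \<open>0\<close>, whose masses are given by
  the marginals.
\<close>

lemma zero_coupling_in_M0:
  assumes \<mu>: "\<mu> \<in> M0" and \<nu>: "\<nu> \<in> M0" and \<gamma>: "zero_coupling \<mu> \<nu> \<gamma>"
  shows "\<gamma> \<in> M0"
  unfolding M0_def
proof (intro CollectI conjI ballI impI)
  show sets: "sets \<gamma> = sets punctured_borel" using \<gamma> unfolding zero_coupling_def by auto
  fix B :: "(real \<times> real) set"
  assume B: "B \<in> sets punctured_borel" "0 \<notin> closure B"
  have "open (- closure B)" "(0, 0) \<in> - closure B"
    using B(2) by (auto simp: zero_prod_def)
  then obtain S T where ST: "open S" "open T" "0 \<in> S" "0 \<in> T" "S \<times> T \<subseteq> - closure B"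
    by (rule open_prod_elim) auto
  have fin: "emeasure M (- W) < \<infinity>" if "M \<in> M0" "open W" "0 \<in> W" for M and W :: "real set"
  proof -
    have "closure (- W) = - W" using that by (intro closure_closed) auto
    then show ?thesis using that unfolding M0_def by (auto simp: sets_punctured_borel_iff)
  qed
  have meas: "(- S) \<times> UNIV \<in> sets \<gamma>" "UNIV \<times> (- T) \<in> sets \<gamma>"
    using ST by (auto intro!: sets_zero_coupling[OF \<gamma>])
  have "B \<subseteq> (- S) \<times> UNIV \<union> UNIV \<times> (- T)"
  proof
    fix p assume "p \<in> B"
    then have "p \<notin> S \<times> T" using ST(5) closure_subset[of B] by auto
    then show "p \<in> (- S) \<times> UNIV \<union> UNIV \<times> (- T)" by (cases p) auto
  qed
  then have "emeasure \<gamma> B \<le> emeasure \<gamma> ((- S) \<times> UNIV \<union> UNIV \<times> (- T))"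
    using meas by (intro emeasure_mono) auto
  also have "\<dots> \<le> emeasure \<gamma> ((- S) \<times> UNIV) + emeasure \<gamma> (UNIV \<times> (- T))"
    using meas by (rule emeasure_subadditive)
  also have "\<dots> = emeasure \<mu> (- S) + emeasure \<nu> (- T)"
    using ST zero_coupling_marginals(1)[OF \<gamma>, of "- S"]
      zero_coupling_marginals(2)[OF \<gamma>, of "- T"] by simp
  also have "\<dots> < \<infinity>" using fin[OF \<mu>] fin[OF \<nu>] ST by simp
  finally show "emeasure \<gamma> B < \<infinity>" .
qed

section \<open>The two half-lines\<close>

lemma half_line_measurable: "{t::real. 0 < s * t} \<in> sets borel"
  by measurable

text \<open>
  If the axis were charged, its mass \<open>d\<close> would have to fit into \<open>\<nu>\<close> of the half-line alongside a
  mass \<open>c\<close> that already accounts for the whole of \<open>\<mu>\<close> on the half-line. Since \<open>c\<close> is finite, the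
  comparison \<open>c + d \<le> c\<close> leaves no room for \<open>d\<close>.
\<close>

lemma axis_half_line_null:
  fixes s :: real
  assumes \<nu>: "\<nu> \<in> M0" and \<gamma>: "zero_coupling \<mu> \<nu> \<gamma>" and mono: "monotone_set (spt \<gamma>)"
    and le: "emeasure \<nu> {t. 0 < s * t} \<le> emeasure \<mu> {t. 0 < s * t}"
  shows "emeasure \<gamma> ({0} \<times> {t. 0 < s * t}) = 0"
proof (rule ccontr)
  define H where "H = {t::real. 0 < s * t}"
  assume "emeasure \<gamma> ({0} \<times> {t. 0 < s * t}) \<noteq> 0"
  then have pos: "emeasure \<gamma> ({0} \<times> H) \<noteq> 0" unfolding H_def .
  have sets: "sets \<gamma> = sets punctured_borel" using \<gamma> unfolding zero_coupling_def by auto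
  have H: "H \<in> sets borel" "0 \<notin> H" unfolding H_def using half_line_measurable by auto
  obtain y0 where y0: "(0, y0) \<in> spt \<gamma>" "0 < s * y0"
    using emeasure_eq_0_if_disjoint_spt[OF sets, of "{0} \<times> H"] pos H
    by (auto simp: zero_prod_def H_def)
  define C where "C = {t::real. s * y0 \<le> s * t}"
  have C_closed: "closed C" unfolding C_def by (intro closed_Collect_le continuous_intros)
  then have C: "C \<in> sets borel" "0 \<notin> C" "0 \<notin> closure C" "C \<subseteq> H"
    using y0(2) by (auto simp: C_def H_def closure_closed)
  note meas = sets_zero_coupling[OF \<gamma>]
  have null: "emeasure \<gamma> (H \<times> (- C)) = 0"
  proof (rule emeasure_eq_0_if_disjoint_spt[OF sets])
    have "y \<in> C" if "(x, y) \<in> spt \<gamma>" "x \<in> H" for x y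
    proof -
      have "0 \<le> x * (y - y0)" using mono that(1) y0(1) unfolding monotone_set_def by fastforce
      \<comment> \<open>Distributing \<open>s * s\<close> over both factors covers the two signs of \<open>s\<close> in one computation.\<close>
      then have "0 \<le> (s * s) * (x * (y - y0))" by (rule mult_nonneg_nonneg[OF zero_le_square])
      also have "\<dots> = (s * x) * (s * y - s * y0)" by (simp add: algebra_simps)
      finally show ?thesis using that(2) unfolding H_def C_def
        by (simp add: zero_le_mult_iff)
    qed
    then show "(H \<times> - C) \<inter> spt \<gamma> = {}" by auto
  qed (use H in \<open>auto simp: zero_prod_def\<close>)
  have split: "H \<times> UNIV = H \<times> C \<union> H \<times> (- C)" by auto
  have "emeasure \<mu> H = emeasure \<gamma> (H \<times> UNIV)" using zero_coupling_marginals(1)[OF \<gamma> H] by simp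
  also have "\<dots> \<le> emeasure \<gamma> (H \<times> C) + emeasure \<gamma> (H \<times> (- C))"
    unfolding split using H C by (intro emeasure_subadditive meas) auto
  finally have \<mu>_le: "emeasure \<mu> H \<le> emeasure \<gamma> (H \<times> C)" using null by simp
  have "emeasure \<gamma> (H \<times> C) \<le> emeasure \<gamma> (UNIV \<times> C)"
    using C by (intro emeasure_mono meas) auto
  also have "\<dots> = emeasure \<nu> C" using zero_coupling_marginals(2)[OF \<gamma> C(1,2)] .
  also have "\<dots> < \<infinity>" using \<nu> C unfolding M0_def by (auto simp: sets_punctured_borel_iff)
  finally have fin: "emeasure \<gamma> (H \<times> C) < \<infinity>" .
  have "emeasure \<gamma> (H \<times> C) + emeasure \<gamma> ({0} \<times> H) = emeasure \<gamma> (H \<times> C \<union> {0} \<times> H)"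
    using H C by (intro plus_emeasure meas) auto
  also have "\<dots> \<le> emeasure \<gamma> (UNIV \<times> H)" using H C by (intro emeasure_mono meas) auto
  also have "\<dots> = emeasure \<nu> H" using zero_coupling_marginals(2)[OF \<gamma> H] .
  also have "\<dots> \<le> emeasure \<gamma> (H \<times> C)" using le \<mu>_le unfolding H_def by simp
  finally have "emeasure \<gamma> (H \<times> C) + emeasure \<gamma> ({0} \<times> H) \<le> emeasure \<gamma> (H \<times> C) + 0" by simp
  then have "emeasure \<gamma> ({0} \<times> H) \<le> 0"
    using fin by (subst (asm) ennreal_add_left_cancel_le) auto
  with pos show False by simp
qed

text \<open>
  With the origin in the support, a monotone support avoids the points whose coordinates have
  opposite signs, so the mass over \<open>s * y > 0\<close> lies over \<open>s * x > 0\<close> or on the \<open>y\<close>-axis.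
\<close>

lemma half_line_mass_le:
  fixes s :: real
  assumes \<gamma>: "zero_coupling \<mu> \<nu> \<gamma>" and mono: "monotone_set (spt \<gamma>)"
    and proper: "proper \<gamma>" and zero: "0 \<in> spt \<gamma>"
  shows "emeasure \<nu> {t. 0 < s * t} \<le> emeasure \<mu> {t. 0 < s * t}"
proof -
  define H where "H = {t::real. 0 < s * t}"
  define N where "N = {t::real. 0 < (- s) * t}"
  have sets: "sets \<gamma> = sets punctured_borel" using \<gamma> unfolding zero_coupling_def by auto
  have HN: "H \<in> sets borel" "N \<in> sets borel" "0 \<notin> H" "0 \<notin> N"
    unfolding H_def N_def using half_line_measurable[of s] half_line_measurable[of "- s"] by auto
  note meas = sets_zero_coupling[OF \<gamma>]
  have null: "emeasure \<gamma> (N \<times> H) = 0"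
  proof (rule emeasure_eq_0_if_disjoint_spt[OF sets])
    have False if "(x, y) \<in> spt \<gamma>" "x \<in> N" "y \<in> H" for x y
    proof -
      have "0 \<le> x * y"
        using mono that(1) zero unfolding monotone_set_def zero_prod_def by fastforce
      then have "0 \<le> (s * s) * (x * y)" by (rule mult_nonneg_nonneg[OF zero_le_square])
      also have "\<dots> = (s * x) * (s * y)" by (simp add: algebra_simps)
      also have "\<dots> < 0" using that(2,3) by (intro mult_neg_pos[of "s * x"]) (simp_all add: N_def H_def)
      finally show False by simp
    qed
    then show "(N \<times> H) \<inter> spt \<gamma> = {}" by auto
  qed (use HN in \<open>auto simp: zero_prod_def\<close>)
  have axis: "emeasure \<gamma> ({0} \<times> (- {0})) = 0" using proper unfolding proper_def .
  have m: "H \<times> UNIV \<in> sets \<gamma>" "{0} \<times> (- {0}) \<in> sets \<gamma>" "N \<times> H \<in> sets \<gamma>"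
    using HN by (auto intro!: meas)
  have "UNIV \<times> H \<subseteq> H \<times> UNIV \<union> ({0} \<times> (- {0}) \<union> N \<times> H)"
    unfolding H_def N_def by (auto simp: zero_less_mult_iff not_less mult_less_0_iff)
  then have "emeasure \<gamma> (UNIV \<times> H) \<le> emeasure \<gamma> (H \<times> UNIV \<union> ({0} \<times> (- {0}) \<union> N \<times> H))"
    using m by (intro emeasure_mono) auto
  also have "\<dots> = emeasure \<gamma> (H \<times> UNIV)"
    using m axis null by (intro emeasure_Un_null_set null_sets.Un) auto
  finally show ?thesis
    using zero_coupling_marginals[OF \<gamma> HN(1,3)] unfolding H_def by simp
qed

section \<open>Characterisation of proper couplings\<close>

theorem proposition3p7:
  fixes \<mu> \<nu> :: "real measure"
  assumes "\<mu> \<in> M0" and "\<nu> \<in> M0"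
  shows "(emeasure \<mu> {0<..} \<ge> emeasure \<nu> {0<..} \<and> emeasure \<mu> {..<0} \<ge> emeasure \<nu> {..<0}
            \<longrightarrow> (\<forall>\<gamma>. zero_coupling \<mu> \<nu> \<gamma> \<and> monotone_set (spt \<gamma>) \<longrightarrow> proper \<gamma>))
       \<and> (emeasure \<mu> (space \<mu>) = \<infinity> \<or> emeasure \<nu> (space \<nu>) = \<infinity>
            \<longrightarrow> (\<exists>\<gamma>. zero_coupling \<mu> \<nu> \<gamma> \<and> proper \<gamma> \<and> monotone_set (spt \<gamma>))
            \<longrightarrow> emeasure \<mu> {0<..} \<ge> emeasure \<nu> {0<..} \<and> emeasure \<mu> {..<0} \<ge> emeasure \<nu> {..<0})"
proof -
  have half_lines: "{0<..} = {t::real. 0 < 1 * t}" "{..<0} = {t::real. 0 < (- 1) * t}"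
    by auto
  have fwd: "proper \<gamma>"
    if le: "emeasure \<mu> {0<..} \<ge> emeasure \<nu> {0<..}" "emeasure \<mu> {..<0} \<ge> emeasure \<nu> {..<0}"
      and \<gamma>: "zero_coupling \<mu> \<nu> \<gamma>" "monotone_set (spt \<gamma>)" for \<gamma>
  proof -
    note null = axis_half_line_null[OF assms(2) \<gamma>, of 1, folded half_lines, OF le(1)]
      axis_half_line_null[OF assms(2) \<gamma>, of "- 1", folded half_lines, OF le(2)]
    have "{0} \<times> {0<..} \<in> sets \<gamma>" "{0} \<times> {..<0} \<in> sets \<gamma>"
      by (auto intro!: sets_zero_coupling[OF \<gamma>(1)])
    then have "{0} \<times> {0<..} \<union> {0} \<times> {..<0} \<in> null_sets \<gamma>"
      using null by (intro null_sets.Un) auto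
    also have "{0} \<times> {0<..} \<union> {0} \<times> {..<0} = {0::real} \<times> (- {0::real})"
      by (intro set_eqI) (force simp: neq_iff)
    finally show ?thesis unfolding proper_def by (rule null_setsD1)
  qed
  have bwd: "emeasure \<mu> {0<..} \<ge> emeasure \<nu> {0<..} \<and> emeasure \<mu> {..<0} \<ge> emeasure \<nu> {..<0}"
    if inf: "emeasure \<mu> (space \<mu>) = \<infinity> \<or> emeasure \<nu> (space \<nu>) = \<infinity>"
      and \<gamma>: "zero_coupling \<mu> \<nu> \<gamma>" "proper \<gamma>" "monotone_set (spt \<gamma>)" for \<gamma>
  proof -
    have \<gamma>M0: "\<gamma> \<in> M0" using zero_coupling_in_M0[OF assms \<gamma>(1)] .
    have space: "space M = - {0}" if "M \<in> M0" for M :: "real measure"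
      using that sets_eq_imp_space_eq[of M punctured_borel] unfolding M0_def
      by (simp add: space_punctured_borel)
    have "emeasure \<mu> (space \<mu>) \<le> emeasure \<gamma> (space \<gamma>)"
      unfolding space[OF assms(1)]
      by (subst zero_coupling_marginals(1)[OF \<gamma>(1), symmetric]) (auto intro: emeasure_space)
    moreover have "emeasure \<nu> (space \<nu>) \<le> emeasure \<gamma> (space \<gamma>)"
      unfolding space[OF assms(2)]
      by (subst zero_coupling_marginals(2)[OF \<gamma>(1), symmetric]) (auto intro: emeasure_space)
    ultimately have "emeasure \<gamma> (space \<gamma>) = \<infinity>" using inf by (auto simp: top_unique)
    then have zero: "0 \<in> spt \<gamma>" by (rule zero_in_spt_if_infinite_mass[OF \<gamma>M0])
    show ?thesis unfolding half_lines
      using half_line_mass_le[OF \<gamma>(1,3,2) zero] by blast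
  qed
  show ?thesis using fwd bwd by blast
qed

end
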